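(* Let $\mathcal{B}$ be a reflexive Banach space over $\mathbb{R}$, let $\Lambda$ be an index set and let $\Phi=(\varphi_\lambda)_{\lambda\in\Lambda}\subset\mathcal{B}'$. Then the map $\mathcal{A}_\Phi:\mathcal{B}/\{1,-1\}\to\mathbb{R}_+^\Lambda$, $x\mapsto(|[x,\varphi_\lambda]|)_{\lambda\in\Lambda}$, is injective if and only if $\Phi$ satisfies the complement property in $\mathcal{B}$.
   Context: $\mathcal{B}'$ is the topological dual of $\mathcal{B}$ and $[x,\psi]:=\psi(x)$. $\mathcal{B}/\{1,-1\}$ is the quotient of $\mathcal{B}$ obtained by identifying $x$ with $-x$. $\mathbb{R}_+=[0,\infty)$. For $S\subset\Lambda$ let $\Phi_S=(\varphi_\lambda)_{\lambda\in S}$ and $(\mathrm{span}\,\Phi_S)_\bot=\{x\in\mathcal{B}:[x,\varphi_\lambda]=0\text{ for all }\lambda\in S\}$. $\Phi$ satisfies the complement property (CP) in $\mathcal{B}$ if for every subset $S\subset\Lambda$, either $(\mathrm{span}\,\Phi_S)_\bot=\{0\}$ or $(\mathrm{span}\,\Phi_{\Lambda\setminus S})_\bot=\{0\}$ (inclusive "or"). *)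

theory Defs
  imports "HOL-Analysis.Analysis"
begin

text \<open>The topological dual of \<open>'a\<close> is the type \<open>'a \<Rightarrow>\<^sub>L real\<close>, and the pairing \<open>[x, \<psi>]\<close> is
  \<open>blinfun_apply \<psi> x\<close>.\<close>

lift_definition canonical_embedding ::
    "'a::real_normed_vector \<Rightarrow> (('a \<Rightarrow>\<^sub>L real) \<Rightarrow>\<^sub>L real)"
  is "\<lambda>x \<psi>. blinfun_apply \<psi> x"
  by (rule blinfun.bounded_linear_left)

definition reflexive_space :: "'a::real_normed_vector itself \<Rightarrow> bool" where
  "reflexive_space _ \<longleftrightarrow>
     surj (canonical_embedding :: 'a \<Rightarrow> (('a \<Rightarrow>\<^sub>L real) \<Rightarrow>\<^sub>L real))"

definition sign_eq :: "'a::real_vector \<Rightarrow> 'a \<Rightarrow> bool" where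
  "sign_eq x y \<longleftrightarrow> x = y \<or> x = - y"

lemma equivp_sign_eq: "equivp sign_eq"
  by (rule equivpI) (auto simp: reflp_def symp_def transp_def sign_eq_def)

quotient_type (overloaded) 'a sign_quotient = "'a::real_vector" / sign_eq
  by (rule equivp_sign_eq)

text \<open>An element of \<open>\<real>\<^sub>+\<^sup>\<Lambda>\<close> is represented by a function in \<open>\<Lambda> \<rightarrow>\<^sub>E {0..}\<close>, that is, one that is
  \<open>undefined\<close> outside \<open>\<Lambda>\<close>.\<close>

lift_definition magnitude_map ::
    "'i set \<Rightarrow> ('i \<Rightarrow> 'a::real_normed_vector \<Rightarrow>\<^sub>L real) \<Rightarrow> 'a sign_quotient \<Rightarrow> ('i \<Rightarrow> real)"
  is "\<lambda>\<Lambda> \<phi> x. \<lambda>l\<in>\<Lambda>. \<bar>blinfun_apply (\<phi> l) x\<bar>"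
  by (auto simp: sign_eq_def blinfun.minus_right)

lemma magnitude_map_in_PiE: "magnitude_map \<Lambda> \<phi> q \<in> \<Lambda> \<rightarrow>\<^sub>E {0..}"
  by transfer auto

definition annihilated_by ::
    "('i \<Rightarrow> 'a::real_normed_vector \<Rightarrow>\<^sub>L real) \<Rightarrow> 'i set \<Rightarrow> 'a set" where
  "annihilated_by \<phi> S = {x. \<forall>l\<in>S. blinfun_apply (\<phi> l) x = 0}"

definition complement_property ::
    "'i set \<Rightarrow> ('i \<Rightarrow> 'a::real_normed_vector \<Rightarrow>\<^sub>L real) \<Rightarrow> bool" where
  "complement_property \<Lambda> \<phi> \<longleftrightarrow>
     (\<forall>S\<subseteq>\<Lambda>. annihilated_by \<phi> S = {0} \<or> annihilated_by \<phi> (\<Lambda> - S) = {0})"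

end

theory Submission
  imports Defs
begin

text \<open>The polarisation \<open>u = x + y\<close>, \<open>v = x - y\<close> turns both properties into the same one: two
  vectors \<open>u\<close>, \<open>v\<close> such that every functional of the family kills \<open>u\<close> or \<open>v\<close> cannot both be nonzero.
  Injectivity takes this form because \<open>[u, \<psi>] [v, \<psi>] = [x, \<psi>]\<^sup>2 - [y, \<psi>]\<^sup>2\<close>, so equal magnitudes of
  \<open>x\<close> and \<open>y\<close> say that every functional kills \<open>u\<close> or \<open>v\<close>, while \<open>x = \<plusminus>y\<close> says that \<open>u\<close> or \<open>v\<close> is
  zero (\<open>inj_magnitude_map_iff\<close>). The complement property takes this form because a pair \<open>u\<close>, \<open>v\<close>
  splits the index set into the functionals that kill \<open>u\<close> and the others, which then kill \<open>v\<close>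
  (\<open>complement_property_iff\<close>).\<close>

lemma abs_blinfun_apply_eq_iff:
  fixes \<psi> :: "'a::real_normed_vector \<Rightarrow>\<^sub>L real"
  shows "\<bar>blinfun_apply \<psi> x\<bar> = \<bar>blinfun_apply \<psi> y\<bar> \<longleftrightarrow>
    blinfun_apply \<psi> (x + y) = 0 \<or> blinfun_apply \<psi> (x - y) = 0"
  by (auto simp: blinfun.add_right blinfun.diff_right abs_eq_iff)

lemma magnitude_map_abs_eq_iff:
  "magnitude_map \<Lambda> \<phi> (abs_sign_quotient x) = magnitude_map \<Lambda> \<phi> (abs_sign_quotient y) \<longleftrightarrow>
    (\<forall>l\<in>\<Lambda>. blinfun_apply (\<phi> l) (x + y) = 0 \<or> blinfun_apply (\<phi> l) (x - y) = 0)"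
  by (auto simp: magnitude_map.abs_eq abs_blinfun_apply_eq_iff[symmetric] restrict_def fun_eq_iff)

lemma abs_sign_quotient_eq_iff:
  "abs_sign_quotient x = abs_sign_quotient y \<longleftrightarrow> x + y = 0 \<or> x - y = 0"
  by (auto simp: sign_quotient.abs_eq_iff sign_eq_def eq_neg_iff_add_eq_0)

lemma inj_magnitude_map_iff:
  fixes \<phi> :: "'i \<Rightarrow> 'a::real_normed_vector \<Rightarrow>\<^sub>L real"
  shows "inj (magnitude_map \<Lambda> \<phi>) \<longleftrightarrow>
    (\<forall>u v. (\<forall>l\<in>\<Lambda>. blinfun_apply (\<phi> l) u = 0 \<or> blinfun_apply (\<phi> l) v = 0) \<longrightarrow> u = 0 \<or> v = 0)"
    (is "_ \<longleftrightarrow> ?separating")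
proof
  assume inj: "inj (magnitude_map \<Lambda> \<phi>)"
  show ?separating
  proof (intro allI impI)
    fix u v
    assume kill: "\<forall>l\<in>\<Lambda>. blinfun_apply (\<phi> l) u = 0 \<or> blinfun_apply (\<phi> l) v = 0"
    \<comment> \<open>These invert the polarisation.\<close>
    define x where "x = (1/2) *\<^sub>R (u + v)"
    define y where "y = (1/2) *\<^sub>R (u - v)"
    have "x + y = (1/2 + 1/2) *\<^sub>R u" "x - y = (1/2 + 1/2) *\<^sub>R v"
      unfolding x_def y_def scaleR_add_left by (simp_all add: algebra_simps)
    then have uv: "x + y = u" "x - y = v"
      by simp_all
    with kill have "magnitude_map \<Lambda> \<phi> (abs_sign_quotient x) = magnitude_map \<Lambda> \<phi> (abs_sign_quotient y)"
      by (simp add: magnitude_map_abs_eq_iff)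
    with inj have "abs_sign_quotient x = abs_sign_quotient y"
      by (rule injD)
    with uv show "u = 0 \<or> v = 0"
      by (simp only: abs_sign_quotient_eq_iff)
  qed
next
  assume sep: ?separating
  show "inj (magnitude_map \<Lambda> \<phi>)"
  proof (rule injI)
    fix p q
    assume eq: "magnitude_map \<Lambda> \<phi> p = magnitude_map \<Lambda> \<phi> q"
    obtain x y where "p = abs_sign_quotient x" "q = abs_sign_quotient y"
      by (metis Quotient_abs_rep Quotient_sign_quotient)
    with eq sep show "p = q"
      by (simp only: magnitude_map_abs_eq_iff abs_sign_quotient_eq_iff)
  qed
qed

lemma annihilated_by_eq_zero_iff:
  "annihilated_by \<phi> S = {0} \<longleftrightarrow> (\<forall>x. (\<forall>l\<in>S. blinfun_apply (\<phi> l) x = 0) \<longrightarrow> x = 0)"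
  by (auto simp: annihilated_by_def blinfun.zero_right)

lemma complement_property_iff:
  "complement_property \<Lambda> \<phi> \<longleftrightarrow>
    (\<forall>u v. (\<forall>l\<in>\<Lambda>. blinfun_apply (\<phi> l) u = 0 \<or> blinfun_apply (\<phi> l) v = 0) \<longrightarrow> u = 0 \<or> v = 0)"
    (is "_ \<longleftrightarrow> ?separating")
proof
  assume cp: "complement_property \<Lambda> \<phi>"
  show ?separating
  proof (intro allI impI)
    fix u v
    assume kill: "\<forall>l\<in>\<Lambda>. blinfun_apply (\<phi> l) u = 0 \<or> blinfun_apply (\<phi> l) v = 0"
    define S where "S = {l \<in> \<Lambda>. blinfun_apply (\<phi> l) u = 0}"
    have "S \<subseteq> \<Lambda>" "\<forall>l\<in>S. blinfun_apply (\<phi> l) u = 0" "\<forall>l\<in>\<Lambda> - S. blinfun_apply (\<phi> l) v = 0"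
      using kill by (auto simp: S_def)
    with cp show "u = 0 \<or> v = 0"
      unfolding complement_property_def annihilated_by_eq_zero_iff by blast
  qed
next
  assume ?separating
  then show "complement_property \<Lambda> \<phi>"
    unfolding complement_property_def annihilated_by_eq_zero_iff by blast
qed

theorem lemma2p3:
  fixes \<Lambda> :: "'i set"
    and \<phi> :: "'i \<Rightarrow> 'a::banach \<Rightarrow>\<^sub>L real"
  assumes "reflexive_space TYPE('a)"
  shows "inj (magnitude_map \<Lambda> \<phi>) \<longleftrightarrow> complement_property \<Lambda> \<phi>"
  by (simp only: inj_magnitude_map_iff complement_property_iff)

end
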